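(* There is a language that is context-free but not counter.
   Context: Languages are over finite alphabets. Let $\Sigma$ be a finite alphabet and $k\ge1$. A (non-deterministic) $\mathbb Z^k$-automaton over $\Sigma$ is a finite directed graph with a start vertex, some accept vertices, and edges labelled by elements of $(\Sigma\cup\{\epsilon\})\times\mathbb Z^k$, where $\epsilon$ is the empty word. It accepts $w\in\Sigma^*$ if there is a path from the start vertex to some accept vertex whose first label components concatenate to $w$ and whose second components sum to $0\in\mathbb Z^k$. A language is $k$-counter if it is the set of words accepted by some $\mathbb Z^k$-automaton, and counter if it is $k$-counter for some $k\ge1$. *)

theory Defs
  imports Main "HOL-Library.Function_Algebras"
begin

section \<open>Context-free languages\<close>

text \<open>In a sentential form, \<^term>\<open>Inl\<close> marks nonterminals and \<^term>\<open>Inr\<close> marks terminals.\<close>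

record ('n, 'a) cfg =
  nonterminals :: "'n set"
  start_symbol :: 'n
  productions :: "('n \<times> ('n + 'a) list) set"

definition is_cfg :: "'a set \<Rightarrow> ('n, 'a) cfg \<Rightarrow> bool" where
  "is_cfg \<Sigma> G \<longleftrightarrow>
     finite (nonterminals G) \<and>
     start_symbol G \<in> nonterminals G \<and>
     finite (productions G) \<and>
     productions G \<subseteq> nonterminals G \<times> lists (nonterminals G <+> \<Sigma>)"

inductive derives1 :: "('n, 'a) cfg \<Rightarrow> ('n + 'a) list \<Rightarrow> ('n + 'a) list \<Rightarrow> bool"
  for G :: "('n, 'a) cfg" where
  "(N, \<alpha>) \<in> productions G \<Longrightarrow> derives1 G (u @ [Inl N] @ v) (u @ \<alpha> @ v)"

definition cfg_language :: "('n, 'a) cfg \<Rightarrow> 'a list set" where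
  "cfg_language G = {w. (derives1 G)\<^sup>*\<^sup>* [Inl (start_symbol G)] (map Inr w)}"

text \<open>Nonterminals may be taken to be natural numbers, since a grammar has only finitely many.\<close>

definition context_free :: "'a set \<Rightarrow> 'a list set \<Rightarrow> bool" where
  "context_free \<Sigma> L \<longleftrightarrow> (\<exists>G :: (nat, 'a) cfg. is_cfg \<Sigma> G \<and> L = cfg_language G)"


section \<open>Counter languages\<close>

text \<open>The group \<open>\<int>\<^sup>k\<close>, with coordinates indexed by \<open>0, \<dots>, k - 1\<close>. Padding by zeros makes
  the pointwise addition and zero of the function type those of \<open>\<int>\<^sup>k\<close>.\<close>

definition int_vectors :: "nat \<Rightarrow> (nat \<Rightarrow> int) set" where
  "int_vectors k = {v. \<forall>i\<ge>k. v i = 0}"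

text \<open>An edge is a triple of source, label and target, where the first component of the label is
  \<^term>\<open>None\<close> for the empty word. Parallel edges with the same label would not change the
  accepted language, so a set of edges suffices.\<close>

type_synonym ('q, 'a) edge = "'q \<times> ('a option \<times> (nat \<Rightarrow> int)) \<times> 'q"

record ('q, 'a) automaton =
  vertices :: "'q set"
  start_vertex :: 'q
  accept_vertices :: "'q set"
  edges :: "('q, 'a) edge set"

definition is_int_automaton :: "nat \<Rightarrow> 'a set \<Rightarrow> ('q, 'a) automaton \<Rightarrow> bool" where
  "is_int_automaton k \<Sigma> A \<longleftrightarrow>
     finite (vertices A) \<and>
     start_vertex A \<in> vertices A \<and>
     accept_vertices A \<subseteq> vertices A \<and>
     finite (edges A) \<and>
     edges A \<subseteq> vertices A \<times> (insert None (Some ` \<Sigma>) \<times> int_vectors k) \<times> vertices A"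

inductive edge_path :: "('q, 'a) automaton \<Rightarrow> 'q \<Rightarrow> ('q, 'a) edge list \<Rightarrow> 'q \<Rightarrow> bool"
  for A :: "('q, 'a) automaton" where
  Nil: "edge_path A p [] p"
| Cons: "(p, l, q) \<in> edges A \<Longrightarrow> edge_path A q es r \<Longrightarrow> edge_path A p ((p, l, q) # es) r"

fun edge_word :: "('q, 'a) edge \<Rightarrow> 'a list" where
  "edge_word (p, (None, v), q) = []"
| "edge_word (p, (Some a, v), q) = [a]"

fun edge_vector :: "('q, 'a) edge \<Rightarrow> nat \<Rightarrow> int" where
  "edge_vector (p, (x, v), q) = v"

definition accepts :: "('q, 'a) automaton \<Rightarrow> 'a list \<Rightarrow> bool" where
  "accepts A w \<longleftrightarrow>
     (\<exists>es. \<exists>q \<in> accept_vertices A. edge_path A (start_vertex A) es q \<and>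
        concat (map edge_word es) = w \<and> sum_list (map edge_vector es) = 0)"

text \<open>As for grammars, natural numbers suffice as vertices.\<close>

definition k_counter :: "nat \<Rightarrow> 'a set \<Rightarrow> 'a list set \<Rightarrow> bool" where
  "k_counter k \<Sigma> L \<longleftrightarrow>
     (\<exists>A :: (nat, 'a) automaton. is_int_automaton k \<Sigma> A \<and> L = {w. accepts A w})"

definition counter :: "'a set \<Rightarrow> 'a list set \<Rightarrow> bool" where
  "counter \<Sigma> L \<longleftrightarrow> (\<exists>k\<ge>1. k_counter k \<Sigma> L)"

end

theory Submission
  imports Defs
begin

text \<open>
  The language is that of the even palindromes \<open>w @ rev w\<close> over two letters. It is generated by
  the grammar \<open>S \<rightarrow> 0 S 0 | 1 S 1 | \<epsilon>\<close>.

  That it is not counter rests on a swapping property (lemma \<open>swapping\<close>). An accepting path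
  of an automaton with \<open>n\<close> vertices is cut at more than \<open>2 * n\<close> positions of the word it
  reads. Three of the cuts then happen at the same vertex, so between them lie two
  consecutive closed paths, reading words \<open>x\<close> and \<open>y\<close> say. Traversing these closed paths in the
  opposite order gives another path between the same vertices, and since \<open>\<int>\<^sup>k\<close> is commutative its
  labels still sum to zero. So the word with \<open>x @ y\<close> replaced by \<open>y @ x\<close> is accepted as well.

  Apply this to the palindrome \<open>w @ rev w\<close> where \<open>w\<close> is the word \<open>1 01 001 0001 \<dots>\<close>,
  cutting only in the first half and only at the boundaries of the blocks \<open>0\<dots>01\<close>. The swap leaves the
  second half alone, so the result is a palindrome only if \<open>x @ y = y @ x\<close>. But \<open>x\<close> and \<open>y\<close> begin
  with blocks of different lengths (lemma \<open>block_concats_not_commute\<close>), so they do not commute.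
\<close>

section \<open>Swapping closed paths in an accepting path\<close>

lemma edge_path_Nil_iff: "edge_path A p [] r \<longleftrightarrow> p = r"
  by (auto intro: edge_path.Nil elim: edge_path.cases)

lemma edge_path_Cons_iff:
  "edge_path A p (e # es) r \<longleftrightarrow> e \<in> edges A \<and> fst e = p \<and> edge_path A (snd (snd e)) es r"
  by (subst edge_path.simps) (cases e; auto)

lemma edge_path_append:
  "edge_path A p (es @ fs) r \<longleftrightarrow> (\<exists>q. edge_path A p es q \<and> edge_path A q fs r)"
  by (induction es arbitrary: p) (simp_all add: edge_path_Nil_iff edge_path_Cons_iff)

lemma edge_path_target_unique: "edge_path A p es q \<Longrightarrow> edge_path A p es r \<Longrightarrow> q = r"
  by (induction es arbitrary: p) (auto simp: edge_path_Nil_iff edge_path_Cons_iff)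

lemma edge_path_target_in_vertices:
  assumes "edge_path A p es q" "is_int_automaton k \<Sigma> A" "p \<in> vertices A"
  shows "q \<in> vertices A"
  using assms by (induction rule: edge_path.induct) (auto simp: is_int_automaton_def)

text \<open>Every prefix of the word read is attained along the path, because an edge reads at most one
  letter.\<close>

lemma path_split_at_word_prefix:
  assumes "concat (map edge_word es) = u @ v"
  shows "\<exists>n. concat (map edge_word (take n es)) = u"
  using assms
proof (induction es arbitrary: u)
  case Nil
  then show ?case by simp
next
  case (Cons e es)
  show ?case
  proof (cases "u = []")
    case True
    then have "concat (map edge_word (take 0 (e # es))) = u" by simp
    then show ?thesis by blast
  next
    case False
    obtain p l q where e: "e = (p, l, q)" by (cases e)
    obtain u' where u': "u = edge_word e @ u'" "concat (map edge_word es) = u' @ v"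
    proof (cases "fst l")
      case None
      then have "edge_word e = []" using e by (cases l) auto
      then show ?thesis using that[of u] Cons.prems by simp
    next
      case (Some a)
      then have "edge_word e = [a]" using e by (cases l) auto
      then show ?thesis using that[of "tl u"] Cons.prems False by (cases u) auto
    qed
    obtain n where "concat (map edge_word (take n es)) = u'" using Cons.IH[OF u'(2)] by blast
    then have "concat (map edge_word (take (Suc n) (e # es))) = u" using u'(1) by simp
    then show ?thesis by blast
  qed
qed

lemma card_gt_2_imp_three_ordered:
  fixes S :: "'b :: linorder set"
  assumes "card S > 2"
  shows "\<exists>i\<in>S. \<exists>j\<in>S. \<exists>k\<in>S. i < j \<and> j < k"
proof -
  have fin: "finite S" using assms card.infinite by fastforce
  have ne: "S \<noteq> {}" using assms by auto
  have "card {Min S, Max S} \<le> 2" by (simp add: card_insert_if)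
  then have "\<not> S \<subseteq> {Min S, Max S}"
    using assms card_mono[of "{Min S, Max S}" S] by (meson finite.intros leD le_trans)
  then obtain j where "j \<in> S" "j \<noteq> Min S" "j \<noteq> Max S" by blast
  moreover have "Min S \<in> S" "Max S \<in> S" using fin ne by auto
  moreover have "Min S \<le> j" "j \<le> Max S" using fin \<open>j \<in> S\<close> by auto
  ultimately show ?thesis by (metis order_le_imp_less_or_eq)
qed

text \<open>The set \<open>P\<close> of admissible cutting positions is what allows control over the shape of the
  words that get swapped.\<close>

lemma swapping:
  fixes A :: "('q, 'a) automaton"
  assumes A: "is_int_automaton k \<Sigma> A"
    and acc: "accepts A w"
    and P: "P \<subseteq> {..length w}" "card P > 2 * card (vertices A)"
  shows "\<exists>u x y z. w = u @ x @ y @ z \<and> x \<noteq> [] \<and> y \<noteq> [] \<and>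
           {length u, length (u @ x), length (u @ x @ y)} \<subseteq> P \<and> accepts A (u @ y @ x @ z)"
proof -
  let ?word = "\<lambda>es. concat (map edge_word es) :: 'a list"
  let ?vec = "\<lambda>es :: ('q, 'a) edge list. sum_list (map edge_vector es)"
  obtain es q where q: "q \<in> accept_vertices A" and path: "edge_path A (start_vertex A) es q"
    and word: "?word es = w" and vec: "?vec es = 0"
    using acc by (auto simp: accepts_def)
  have start: "start_vertex A \<in> vertices A" and finV: "finite (vertices A)"
    using A by (auto simp: is_int_automaton_def)
  have "\<exists>n. ?word (take n es) = take i w" for i
    using path_split_at_word_prefix[of es "take i w" "drop i w"] word by simp
  then obtain n where n: "\<And>i. ?word (take (n i) es) = take i w" by metis
  have "\<exists>s. edge_path A (start_vertex A) (take (n i) es) s" for i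
    using path edge_path_append[of A _ "take (n i) es" "drop (n i) es"] by auto
  then obtain s where s: "\<And>i. edge_path A (start_vertex A) (take (n i) es) (s i)" by metis
  have sV: "s i \<in> vertices A" for i
    using edge_path_target_in_vertices[OF s A start] .
  have "\<exists>t. 2 < card (s -` {t} \<inter> P)"
  proof (rule ccontr)
    assume "\<not> ?thesis"
    then have "card (s -` {t} \<inter> P) \<le> 2" for t by (simp add: not_less)
    then have "(\<Sum>t\<in>vertices A. card (s -` {t} \<inter> P)) \<le> card (vertices A) * 2"
      using sum_bounded_above[of "vertices A" "\<lambda>t. card (s -` {t} \<inter> P)" 2]
      by simp
    moreover have "P = (\<Union>t\<in>vertices A. s -` {t} \<inter> P)" using sV by auto
    then have "card P \<le> (\<Sum>t\<in>vertices A. card (s -` {t} \<inter> P))"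
      using card_UN_le[OF finV] by metis
    ultimately show False using P(2) by linarith
  qed
  then obtain t where "2 < card (s -` {t} \<inter> P)" by blast
  then obtain a b c where abc: "a < b" "b < c" "a \<in> P" "b \<in> P" "c \<in> P" "s a = t" "s b = t" "s c = t"
    using card_gt_2_imp_three_ordered by (metis IntD1 IntD2 vimage_singleton_eq)
  have len: "length (take i w) = i" if "i \<in> P" for i using that P(1) by auto
  have mono: "n i \<le> n j" if "i < j" "i \<in> P" "j \<in> P" for i j
  proof (rule ccontr)
    assume "\<not> n i \<le> n j"
    then have "take (n i) es = take (n j) es @ take (n i - n j) (drop (n j) es)"
      by (metis le_add_diff_inverse nat_le_linear take_add)
    then have "take i w = take j w @ ?word (take (n i - n j) (drop (n j) es))"
      by (metis n concat_append map_append)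
    then have "length (take j w) \<le> length (take i w)" by simp
    then show False using len that by simp
  qed
  define es1 where "es1 = take (n a) es"
  define es2 where "es2 = take (n b - n a) (drop (n a) es)"
  define es3 where "es3 = take (n c - n b) (drop (n b) es)"
  define es4 where "es4 = drop (n c) es"
  have tb: "take (n b) es = es1 @ es2" and tc: "take (n c) es = es1 @ es2 @ es3"
    using mono[of a b] mono[of b c] abc unfolding es1_def es2_def es3_def
    by (metis le_add_diff_inverse take_add append.assoc)+
  have es: "es = es1 @ es2 @ es3 @ es4"
    using tc unfolding es4_def by (metis append.assoc append_take_drop_id)
  define u x y z where "u = ?word es1" and "x = ?word es2" and "y = ?word es3" and "z = ?word es4"
  have w: "w = u @ x @ y @ z" using word es by (simp add: u_def x_def y_def z_def)
  have cuts: "take a w = u" "take b w = u @ x" "take c w = u @ x @ y"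
    using n[of a] n[of b] n[of c] tb tc by (simp_all add: u_def x_def y_def es1_def)
  then have lens: "length u = a" "length (u @ x) = b" "length (u @ x @ y) = c"
    using len abc by metis+
  \<comment> \<open>The closed paths \<open>es2\<close> and \<open>es3\<close> at the vertex \<open>t\<close> are traversed in the opposite order.\<close>
  have p1: "edge_path A (start_vertex A) es1 t" using s[of a] abc by (simp add: es1_def)
  have at: "edge_path A (start_vertex A) (es1 @ es2) t"
    "edge_path A (start_vertex A) (es1 @ es2 @ es3) t"
    using s[of b] s[of c] abc tb tc by simp_all
  have closed2: "edge_path A t es2 t"
    using at(1) p1 edge_path_target_unique by (metis edge_path_append)
  have closed3: "edge_path A t es3 t"
    using at p1 edge_path_target_unique by (metis append.assoc edge_path_append)
  have p4: "edge_path A t es4 q"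
    using path es at(2) edge_path_target_unique by (metis append.assoc edge_path_append)
  have "edge_path A (start_vertex A) (es1 @ es3 @ es2 @ es4) q"
    using p1 closed2 closed3 p4 by (auto simp: edge_path_append)
  moreover have "?word (es1 @ es3 @ es2 @ es4) = u @ y @ x @ z"
    by (simp add: u_def x_def y_def z_def)
  moreover have "?vec (es1 @ es3 @ es2 @ es4) = 0"
    using vec unfolding es by (simp add: add.left_commute)
  ultimately have "accepts A (u @ y @ x @ z)" using q unfolding accepts_def by blast
  moreover have "x \<noteq> []" "y \<noteq> []" using lens abc(1,2) by auto
  moreover have "{length u, length (u @ x), length (u @ x @ y)} \<subseteq> P" using lens abc by simp
  ultimately show ?thesis using w by blast
qed

section \<open>Concatenations of blocks of zeros ended by ones\<close>

definition blocks :: "nat \<Rightarrow> nat \<Rightarrow> nat list" where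
  "blocks i j = concat (map (\<lambda>n. replicate n 0 @ [1]) [i..<j])"

lemma blocks_append: "i \<le> j \<Longrightarrow> j \<le> k \<Longrightarrow> blocks i k = blocks i j @ blocks j k"
  unfolding blocks_def by (metis concat_append le_add_diff_inverse map_append upt_add_eq_append)

lemma blocks_rec: "i < j \<Longrightarrow> blocks i j = replicate i 0 @ 1 # blocks (Suc i) j"
  by (simp add: blocks_def upt_conv_Cons)

lemma set_blocks: "set (blocks i j) \<subseteq> {0, 1}"
  by (auto simp: blocks_def)

lemma strict_mono_length_blocks: "strict_mono (\<lambda>j. length (blocks 0 j))"
  by (simp add: strict_mono_Suc_iff blocks_def)

lemma block_concats_not_commute:
  assumes "i < j" "j < k"
  shows "blocks i j @ blocks j k \<noteq> blocks j k @ blocks i j"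
proof
  assume "blocks i j @ blocks j k = blocks j k @ blocks i j"
  \<comment> \<open>The left word has a one at position \<open>i\<close>, where the right word still has one of its \<open>j > i\<close>
    initial zeros.\<close>
  then have "(blocks i j @ blocks j k) ! i = (blocks j k @ blocks i j) ! i" by simp
  then show False using assms by (simp add: blocks_rec nth_append)
qed

section \<open>The language of even palindromes\<close>

definition even_palindromes :: "nat list set" where
  "even_palindromes = {w @ rev w | w. w \<in> lists {0, 1}}"

definition palindrome_grammar :: "(nat, nat) cfg" where
  "palindrome_grammar = \<lparr>nonterminals = {0}, start_symbol = 0,
     productions = {(0, [Inr 0, Inl 0, Inr 0]), (0, [Inr 1, Inl 0, Inr 1]), (0, [])}\<rparr>"

lemma is_cfg_palindrome_grammar: "is_cfg {0, 1} palindrome_grammar"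
  by (auto simp: is_cfg_def palindrome_grammar_def)

lemma split_at_unique_nonterminal:
  assumes "map Inr x @ Inl M # map Inr y = u @ Inl N # v"
  shows "u = map Inr x \<and> N = M \<and> v = map Inr y"
  using assms
proof (induction x arbitrary: u)
  case Nil
  then show ?case by (cases u) (auto simp: map_eq_append_conv map_eq_Cons_conv)
next
  case (Cons a x)
  then show ?case by (cases u) auto
qed

text \<open>The invariant of all derivations: the letters on the two sides of the only nonterminal mirror
  each other, and they still do once the nonterminal is erased.\<close>

lemma palindrome_sentential_forms:
  assumes "(derives1 palindrome_grammar)\<^sup>*\<^sup>* [Inl 0] \<alpha>"
  shows "\<exists>w\<in>lists {0, 1}. \<alpha> = map Inr w @ Inl 0 # map Inr (rev w) \<or> \<alpha> = map Inr (w @ rev w)"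
  using assms
proof (induction rule: rtranclp_induct)
  case base
  show ?case by (rule bexI[of _ "[]"]) auto
next
  case (step \<alpha> \<beta>)
  obtain N \<gamma> u v where prod: "(N, \<gamma>) \<in> productions palindrome_grammar"
    and \<alpha>: "\<alpha> = u @ Inl N # v" and \<beta>: "\<beta> = u @ \<gamma> @ v"
    using step.hyps(2) by (cases rule: derives1.cases) auto
  obtain w where w: "w \<in> lists {0, 1}"
    and "\<alpha> = map Inr w @ Inl 0 # map Inr (rev w) \<or> \<alpha> = map Inr (w @ rev w)"
    using step.IH by blast
  moreover have "\<alpha> \<noteq> map Inr (w @ rev w)"
  proof
    assume "\<alpha> = map Inr (w @ rev w)"
    moreover have "Inl N \<in> set \<alpha>" using \<alpha> by simp
    ultimately show False by auto
  qed
  ultimately have "u = map Inr w" "v = map Inr (rev w)"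
    using split_at_unique_nonterminal \<alpha> by metis+
  then have \<beta>': "\<beta> = map Inr w @ \<gamma> @ map Inr (rev w)" using \<beta> by simp
  consider a where "a \<in> {0, 1}" "\<gamma> = [Inr a, Inl 0, Inr a]" | "\<gamma> = []"
    using prod by (auto simp: palindrome_grammar_def)
  then show ?case
  proof cases
    case (1 a)
    then have "w @ [a] \<in> lists {0, 1}"
      "\<beta> = map Inr (w @ [a]) @ Inl 0 # map Inr (rev (w @ [a]))"
      using w \<beta>' by auto
    then show ?thesis by blast
  next
    case 2
    then have "\<beta> = map Inr (w @ rev w)" using \<beta>' by simp
    then show ?thesis using w by blast
  qed
qed

lemma derives_around_nonterminal:
  assumes "w \<in> lists {0, 1}"
  shows "(derives1 palindrome_grammar)\<^sup>*\<^sup>* [Inl 0] (map Inr w @ Inl 0 # map Inr (rev w))"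
  using assms
proof (induction w rule: rev_induct)
  case Nil
  then show ?case by simp
next
  case (snoc a w)
  then have "(0, [Inr a, Inl 0, Inr a]) \<in> productions palindrome_grammar"
    by (auto simp: palindrome_grammar_def)
  from derives1.intros[OF this, of "map Inr w" "map Inr (rev w)"] snoc
  show ?case by (auto elim: rtranclp.rtrancl_into_rtrancl)
qed

lemma cfg_language_palindrome_grammar: "cfg_language palindrome_grammar = even_palindromes"
proof (intro set_eqI iffI)
  fix x
  assume "x \<in> cfg_language palindrome_grammar"
  then have deriv: "(derives1 palindrome_grammar)\<^sup>*\<^sup>* [Inl 0] (map Inr x)"
    by (simp add: cfg_language_def palindrome_grammar_def)
  define \<alpha> :: "(nat + nat) list" where "\<alpha> = map Inr x"
  obtain w where w: "w \<in> lists {0, 1}"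
    and "\<alpha> = map Inr w @ Inl 0 # map Inr (rev w) \<or> \<alpha> = map Inr (w @ rev w)"
    using palindrome_sentential_forms deriv unfolding \<alpha>_def by blast
  moreover have "\<alpha> \<noteq> map Inr w @ Inl 0 # map Inr (rev w)"
    by (auto simp: \<alpha>_def map_eq_append_conv map_eq_Cons_conv)
  ultimately have "\<alpha> = map Inr (w @ rev w)" by blast
  then have "x = w @ rev w" unfolding \<alpha>_def by (metis inj_Inr inj_map_eq_map)
  then show "x \<in> even_palindromes" using w by (auto simp: even_palindromes_def)
next
  fix x
  assume "x \<in> even_palindromes"
  then obtain w where w: "w \<in> lists {0, 1}" and x: "x = w @ rev w"
    by (auto simp: even_palindromes_def)
  have "(0, []) \<in> productions palindrome_grammar" by (simp add: palindrome_grammar_def)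
  from derives1.intros[OF this, of "map Inr w" "map Inr (rev w)"]
  have "derives1 palindrome_grammar (map Inr w @ Inl 0 # map Inr (rev w)) (map Inr x)"
    by (simp add: x)
  with derives_around_nonterminal[OF w]
  have "(derives1 palindrome_grammar)\<^sup>*\<^sup>* [Inl 0] (map Inr x)"
    by (rule rtranclp.rtrancl_into_rtrancl)
  then show "x \<in> cfg_language palindrome_grammar"
    by (simp add: cfg_language_def palindrome_grammar_def)
qed

lemma even_palindromes_not_counter: "\<not> counter \<Sigma> even_palindromes"
proof
  assume "counter \<Sigma> even_palindromes"
  then obtain k and A :: "(nat, nat) automaton"
    where A: "is_int_automaton k \<Sigma> A" and L: "even_palindromes = {w. accepts A w}"
    by (auto simp: counter_def k_counter_def)
  define N where "N = 2 * card (vertices A)"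
  \<comment> \<open>The boundaries of \<open>N\<close> blocks, with position \<open>0\<close> among them, are \<open>N + 1\<close> positions.\<close>
  define P where "P = (\<lambda>i. length (blocks 0 i)) ` {..N}"
  have "blocks 0 N @ rev (blocks 0 N) \<in> even_palindromes"
    using set_blocks unfolding even_palindromes_def by (auto simp: in_lists_conv_set)
  then have acc: "accepts A (blocks 0 N @ rev (blocks 0 N))" using L by blast
  have P: "P \<subseteq> {..length (blocks 0 N @ rev (blocks 0 N))}"
    using strict_mono_less_eq[OF strict_mono_length_blocks] by (auto simp: P_def intro: trans_le_add1)
  have "inj (\<lambda>i. length (blocks 0 i))"
    using strict_mono_length_blocks by (rule strict_mono_imp_inj_on)
  then have "card P = Suc N" unfolding P_def by (subst card_image) (auto intro: inj_on_subset)
  then have cardP: "card P > 2 * card (vertices A)" by (simp add: N_def)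
  obtain u x y z where w: "blocks 0 N @ rev (blocks 0 N) = u @ x @ y @ z"
    and ne: "x \<noteq> []" "y \<noteq> []"
    and cuts: "{length u, length (u @ x), length (u @ x @ y)} \<subseteq> P"
    and swapped: "accepts A (u @ y @ x @ z)"
    using swapping[OF A acc P cardP] by (elim exE conjE)
  obtain a b c where le: "a \<le> N" "b \<le> N" "c \<le> N"
    and len: "length u = length (blocks 0 a)" "length (u @ x) = length (blocks 0 b)"
      "length (u @ x @ y) = length (blocks 0 c)"
    using cuts by (auto simp: P_def)
  have "length (blocks 0 a) < length (blocks 0 b)" "length (blocks 0 b) < length (blocks 0 c)"
    using len ne by (simp_all flip: length_greater_0_conv)
  then have less: "a < b" "b < c" using strict_mono_less[OF strict_mono_length_blocks] by simp_all
  have "blocks 0 N = blocks 0 a @ blocks a b @ blocks b c @ blocks c N"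
    using less le blocks_append[of 0 a N] blocks_append[of a b N] blocks_append[of b c N] by simp
  with w have "blocks 0 a @ blocks a b @ blocks b c @ blocks c N @ rev (blocks 0 N) = u @ x @ y @ z"
    by simp
  moreover have "length (blocks a b) = length x" "length (blocks b c) = length y"
    using len less blocks_append[of 0 a b] blocks_append[of 0 b c] by simp_all
  ultimately have eqs: "u = blocks 0 a" "x = blocks a b" "y = blocks b c"
    "z = blocks c N @ rev (blocks 0 N)"
    using len by (auto simp: append_eq_append_conv)
  \<comment> \<open>All cuts lie in the first half, so the swap only changes it, from \<open>blocks 0 N\<close> to \<open>w'\<close>.\<close>
  define w' where "w' = u @ y @ x @ blocks c N"
  have w_eq: "blocks 0 N = u @ x @ y @ blocks c N"
    unfolding eqs by fact
  have "w' @ rev (blocks 0 N) \<in> even_palindromes"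
    unfolding L w'_def using swapped eqs(4) by simp
  then obtain v where "w' @ rev (blocks 0 N) = v @ rev v" by (auto simp: even_palindromes_def)
  moreover have "length w' = length (blocks 0 N)" by (simp add: w'_def w_eq)
  moreover from calculation have "length w' = length v"
    by (metis add_self_div_2 length_append length_rev)
  ultimately have "w' = v" "rev (blocks 0 N) = rev v" by simp_all
  then have "w' = blocks 0 N" by simp
  then have "x @ y = y @ x" by (simp add: w'_def w_eq)
  then show False using block_concats_not_commute[OF less] eqs by simp
qed

theorem theorem3p1:
  "\<exists>(\<Sigma> :: nat set) (L :: nat list set).
     finite \<Sigma> \<and> L \<subseteq> lists \<Sigma> \<and> context_free \<Sigma> L \<and> \<not> counter \<Sigma> L"
proof (intro exI conjI)
  show "finite {0, 1 :: nat}" by simp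
  show "even_palindromes \<subseteq> lists {0, 1}" by (auto simp: even_palindromes_def)
  show "context_free {0, 1} even_palindromes"
    unfolding context_free_def
    using is_cfg_palindrome_grammar cfg_language_palindrome_grammar by metis
  show "\<not> counter {0, 1} even_palindromes" by (rule even_palindromes_not_counter)
qed

end
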